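(* Let $(X,\mathscr{B},\mu,T)$ be a weakly mixing measure preserving system and let $f \in L^1(X,\mu)$ satisfy $\int_X f\,d\mu = 0$. Then for $\mu$-a.e. $x \in X$, the sequence $\left(f(T^n x)\right)_{n=1}^{\infty}$ is a weakly mixing sequence.
   Context: A measure preserving system (m.p.s.) $(X,\mathscr{B},\mu,T)$ consists of a set $X$, a $\sigma$-algebra $\mathscr{B}$ of subsets of $X$, a probability measure $\mu$ on $(X,\mathscr{B})$ and a measurable transformation $T:X\to X$ with $\mu(A)=\mu(T^{-1}A)$ for all $A\in\mathscr{B}$. Functions are complex-valued and $\mathbb{N}=\{1,2,3,\dots\}$. The m.p.s. $(X,\mathscr{B},\mu,T)$ is weakly mixing if for every $A,B\in\mathscr{B}$, $\lim_{N\to\infty}\frac1N\sum_{n=1}^N|\mu(A\cap T^{-n}B)-\mu(A)\mu(B)|=0$. Weakly mixing sequence: let $(x_n)_{n=1}^\infty\subseteq\mathbb{C}$ satisfy $\limsup_{N\to\infty}\frac1N\sum_{n=1}^N|x_n|<\infty$. Then $(x_n)_{n=1}^\infty$ is a weakly mixing sequence if the following holds: whenever $(y_n)_{n=1}^\infty\subseteq\mathbb{C}$ is a bounded sequence and $(N_q)_{q=1}^\infty\subseteq\mathbb{N}$ is a strictly increasing sequence such that $\ell(h):=\lim_{q\to\infty}\frac{1}{N_q}\sum_{n=1}^{N_q}x_{n+h}\overline{y_n}$ exists for every $h\in\mathbb{N}$, we have $\lim_{H\to\infty}\frac1H\sum_{h=1}^H|\ell(h)|=0$. *)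

theory Defs
  imports "HOL-Probability.Probability"
begin

locale measure_preserving_system = prob_space M
  for M :: "'a measure" and T :: "'a \<Rightarrow> 'a" +
  assumes T_measurable: "T \<in> measurable M M"
    and T_preserves: "A \<in> sets M \<Longrightarrow> measure M (T -` A \<inter> space M) = measure M A"

locale weakly_mixing_system = measure_preserving_system +
  assumes weakly_mixing:
    "A \<in> sets M \<Longrightarrow> B \<in> sets M \<Longrightarrow>
      (\<lambda>N::nat. (\<Sum>n=1..N. \<bar>measure M (A \<inter> ((T ^^ n) -` B \<inter> space M)) - measure M A * measure M B\<bar>) / real N)
        \<longlonglongrightarrow> 0"

text \<open>
  Sequences indexed by the positive integers are modelled as functions on \<open>nat\<close> whose value
  at \<open>0\<close> is irrelevant. The first conjunct is the standing growth assumption on \<open>x\<close>, and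
  \<open>l\<close> ranges over all families of limits \<open>l h = lim\<^sub>q\<close> of the correlation averages along \<open>Nq\<close>.
\<close>

definition weakly_mixing_sequence :: "(nat \<Rightarrow> complex) \<Rightarrow> bool" where
  "weakly_mixing_sequence x \<longleftrightarrow>
     limsup (\<lambda>N::nat. ereal ((\<Sum>n=1..N. cmod (x n)) / real N)) < \<infinity> \<and>
     (\<forall>(y :: nat \<Rightarrow> complex) (Nq :: nat \<Rightarrow> nat) (l :: nat \<Rightarrow> complex).
        bounded (y ` {1..}) \<longrightarrow>
        strict_mono_on {1..} Nq \<longrightarrow> (\<forall>q\<ge>1. 1 \<le> Nq q) \<longrightarrow>
        (\<forall>h\<ge>1. (\<lambda>q. (\<Sum>n=1..Nq q. x (n + h) * cnj (y n)) / of_nat (Nq q)) \<longlonglongrightarrow> l h) \<longrightarrow>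
        (\<lambda>H::nat. (\<Sum>h=1..H. cmod (l h)) / real H) \<longlonglongrightarrow> 0)"

end

theory Submission
  imports Defs
begin

text \<open>
  Two facts carry the proof.

  The first is a uniform mean estimate. If \<open>f\<close> has integral zero, then the \<open>L\<^sup>1\<close>-norm of
  \<open>(\<Sum>h=1..H. c h * f (T\<^sup>h x)) / H\<close> tends to zero as \<open>H\<close> grows, uniformly over all weights
  \<open>c\<close> bounded by one (\<open>weighted_averages_L1_small\<close>). For a centred indicator the \<open>L\<^sup>2\<close>-norm expands
  into the correlations \<open>\<mu>(A \<inter> T\<^sup>-\<^sup>m A) - \<mu>(A)\<^sup>2\<close>, whose absolute Cesaro means vanish by weak
  mixing; the weights disappear because only absolute values of correlations matter. The
  property is stable under sums and \<open>L\<^sup>1\<close>-limits, hence holds for all integrable functions.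

  The second is the upper half of the pointwise ergodic theorem: the averages of an integrable
  real function along almost every orbit eventually stay below any number exceeding its integral
  (\<open>orbit_averages_eventually_le\<close>).

  Now let \<open>y\<close> be bounded by \<open>K\<close> and let \<open>l h\<close> be the limiting correlations along \<open>Nq\<close> at a point
  \<open>x\<close>. Then \<open>\<Sum>h=1..H. \<bar>l h\<bar>\<close> is at most twice \<open>\<bar>\<Sum>h=1..H. s h * l h\<bar>\<close> for a suitable choice of
  signs \<open>s\<close>. The latter sum is a limit of correlations of \<open>y\<close> with the orbit of the \<^emph>\<open>single function\<close>
  \<open>\<Sum>h=1..H. s h * f \<circ> T\<^sup>h\<close>, so it is at most \<open>K\<close> times a limit superior of orbit averages of the
  modulus of that function; by the second fact this is at most \<open>K\<close> times its \<open>L\<^sup>1\<close>-norm, which is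
  \<open>o(H)\<close> by the first. Only finitely many sign patterns occur for each \<open>H\<close>, so one null
  set serves all \<open>y\<close>, \<open>Nq\<close> and \<open>l\<close>.
\<close>

section \<open>Invariance of integrals\<close>

context measure_preserving_system
begin

lemma measurable_funpow [measurable]: "T ^^ n \<in> measurable M M"
  using T_measurable by (rule measurable_compose_n)

lemma distr_T: "distr M M T = M"
  by (rule measure_eqI)
     (auto simp: emeasure_distr T_measurable emeasure_eq_measure T_preserves)

lemma distr_funpow: "distr M M (T ^^ n) = M"
proof (induction n)
  case 0
  show ?case by (simp add: id_def distr_id2)
next
  case (Suc n)
  have "distr M M (T ^^ Suc n) = distr (distr M M (T ^^ n)) M T"
    using T_measurable by (simp add: distr_distr comp_def)
  then show ?case by (simp only: Suc distr_T)
qed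

lemma integrable_funpow:
  fixes F :: "'a \<Rightarrow> 'b::{banach, second_countable_topology}"
  assumes "integrable M F"
  shows "integrable M (\<lambda>x. F ((T ^^ n) x))"
  using assms integrable_distr_eq[of "T ^^ n" M M F] by (simp add: distr_funpow)

lemma integral_funpow:
  fixes F :: "'a \<Rightarrow> 'b::{banach, second_countable_topology}"
  assumes "F \<in> borel_measurable M"
  shows "(LINT x|M. F ((T ^^ n) x)) = (LINT x|M. F x)"
  using assms integral_distr[of "T ^^ n" M M F] by (simp add: distr_funpow)

lemma measure_funpow:
  assumes "A \<in> sets M"
  shows "measure M ((T ^^ n) -` A \<inter> space M) = measure M A"
  using assms measure_distr[of "T ^^ n" M M A] by (simp add: distr_funpow)

section \<open>Orbit averages lie below the integral\<close>

text \<open>The maximum of zero and the first \<open>n\<close> partial sums of \<open>G\<close> along the orbit of \<open>x\<close>, written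
  as a recursion because the proof only uses how it changes along \<open>T\<close>.\<close>

fun max_orbit_sum :: "('a \<Rightarrow> real) \<Rightarrow> nat \<Rightarrow> 'a \<Rightarrow> real" where
  "max_orbit_sum G 0 x = 0"
| "max_orbit_sum G (Suc n) x = max 0 (G x + max_orbit_sum G n (T x))"

lemma max_orbit_sum_nonneg: "max_orbit_sum G n x \<ge> 0"
  by (cases n) auto

lemma max_orbit_sum_Suc_ge: "max_orbit_sum G n x \<le> max_orbit_sum G (Suc n) x"
proof (induction n arbitrary: x)
  case (Suc n)
  from Suc[of "T x"] show ?case by auto
qed auto

lemma max_orbit_sum_mono: "m \<le> n \<Longrightarrow> max_orbit_sum G m x \<le> max_orbit_sum G n x"
  using lift_Suc_mono_le[of "\<lambda>n. max_orbit_sum G n x"] max_orbit_sum_Suc_ge by blast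

text \<open>The sum over times \<open>1..N\<close> misses the time-zero value \<open>G x\<close>, which is finite and so does not
  affect boundedness.\<close>

lemma orbit_sum_le_max_orbit_sum:
  "G x + (\<Sum>n=1..N. G ((T ^^ n) x)) \<le> max_orbit_sum G (Suc N) x"
proof (induction N arbitrary: x)
  case (Suc N)
  have "(\<Sum>n=1..Suc N. G ((T ^^ n) x)) = (\<Sum>n=Suc 0..Suc N. G ((T ^^ n) x))"
    by simp
  also have "\<dots> = G (T x) + (\<Sum>n=Suc 0..N. G ((T ^^ Suc n) x))"
    by (subst sum.atLeast_Suc_atMost) (simp_all only: sum.shift_bounds_cl_Suc_ivl, simp_all)
  also have "(\<Sum>n=Suc 0..N. G ((T ^^ Suc n) x)) = (\<Sum>n=1..N. G ((T ^^ n) (T x)))"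
    by (simp add: funpow_swap1)
  finally show ?case using Suc[of "T x"] by simp
qed simp

lemma integrable_max_orbit_sum:
  assumes "integrable M G"
  shows "integrable M (max_orbit_sum G n)"
proof (induction n)
  case 0
  have "max_orbit_sum G 0 = (\<lambda>x. 0)" by auto
  then show ?case by simp
next
  case (Suc n)
  have "integrable M (\<lambda>x. max_orbit_sum G n (T x))"
    using integrable_funpow[OF Suc.IH, of 1] by (simp del: max_orbit_sum.simps)
  then have "integrable M (\<lambda>x. max 0 (G x + max_orbit_sum G n (T x)))"
    using assms by (intro integrable_max) auto
  moreover have "max_orbit_sum G (Suc n) = (\<lambda>x. max 0 (G x + max_orbit_sum G n (T x)))"
    by auto
  ultimately show ?case by simp
qed

definition unbounded_orbit_sums :: "('a \<Rightarrow> real) \<Rightarrow> 'a set" where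
  "unbounded_orbit_sums G = {x \<in> space M. \<forall>b::nat. \<exists>n. real b < max_orbit_sum G n x}"

lemma sets_unbounded_orbit_sums:
  assumes "integrable M G"
  shows "unbounded_orbit_sums G \<in> sets M"
proof -
  have [measurable]: "max_orbit_sum G n \<in> borel_measurable M" for n
    using integrable_max_orbit_sum[OF assms] by auto
  show ?thesis unfolding unbounded_orbit_sums_def by measurable
qed

text \<open>Moving from \<open>T x\<close> to \<open>x\<close> changes the running maxima by the finite amount \<open>G x\<close>, so whether
  they are bounded is a property of the orbit.\<close>

lemma unbounded_orbit_sums_invariant:
  "T -` unbounded_orbit_sums G \<inter> space M = unbounded_orbit_sums G"
proof -
  have sp: "T x \<in> space M" if "x \<in> space M" for x
    using T_measurable that by (rule measurable_space)
  have "(\<forall>b::nat. \<exists>n. real b < max_orbit_sum G n (T x)) \<longleftrightarrow>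
        (\<forall>b::nat. \<exists>n. real b < max_orbit_sum G n x)" for x
  proof (intro iffI allI)
    fix b :: nat
    assume u: "\<forall>b::nat. \<exists>n. real b < max_orbit_sum G n (T x)"
    obtain b' :: nat where "real b + \<bar>G x\<bar> \<le> real b'"
      using real_arch_simple by blast
    moreover obtain n where "real b' < max_orbit_sum G n (T x)"
      using u by blast
    ultimately have "real b < max_orbit_sum G (Suc n) x" by auto
    then show "\<exists>n. real b < max_orbit_sum G n x" by blast
  next
    fix b :: nat
    assume u: "\<forall>b::nat. \<exists>n. real b < max_orbit_sum G n x"
    obtain b' :: nat where "real b + \<bar>G x\<bar> \<le> real b'"
      using real_arch_simple by blast
    moreover obtain n where n: "real b' < max_orbit_sum G n x"
      using u by blast
    moreover obtain m where "n = Suc m"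
      using n by (cases n) auto
    ultimately have "real b < max_orbit_sum G m (T x)" by auto
    then show "\<exists>n. real b < max_orbit_sum G n (T x)" by blast
  qed
  then show ?thesis
    unfolding unbounded_orbit_sums_def using sp by auto
qed

text \<open>The increments \<open>max_orbit_sum G (Suc n) - max_orbit_sum G n \<circ> T\<close> have nonnegative integral,
  by invariance and monotonicity in \<open>n\<close>. They equal
  \<open>max (- max_orbit_sum G n (T x)) (G x)\<close>, which is eventually \<open>G x\<close> wherever the running maxima
  are unbounded. Unboundedness almost everywhere therefore forces the integral of \<open>G\<close> to be
  nonnegative.\<close>

lemma integral_nonneg_if_unbounded_orbit_sums:
  assumes G: "integrable M G"
    and ae: "AE x in M. x \<in> unbounded_orbit_sums G"
  shows "(LINT x|M. G x) \<ge> 0"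
proof -
  let ?m = "max_orbit_sum G"
  define d where "d n x = ?m (Suc n) x - ?m n (T x)" for n x
  have d_eq: "d n x = max (- ?m n (T x)) (G x)" for n x
    by (auto simp: d_def)
  have m_int: "integrable M (?m n)" for n
    by (rule integrable_max_orbit_sum[OF G])
  have mT_int: "integrable M (\<lambda>x. ?m n (T x))" for n
    using integrable_funpow[where n = 1, OF m_int] by simp
  have d_meas: "d n \<in> borel_measurable M" for n
    unfolding d_def
    by (intro borel_measurable_diff borel_measurable_integrable m_int mT_int)
  have nonneg: "(LINT x|M. d n x) \<ge> 0" for n
  proof -
    have "(LINT x|M. d n x) = (LINT x|M. ?m (Suc n) x) - (LINT x|M. ?m n (T x))"
      unfolding d_def by (intro Bochner_Integration.integral_diff m_int mT_int)
    also have "(LINT x|M. ?m n (T x)) = (LINT x|M. ?m n x)"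
      using integral_funpow[of "?m n" 1] m_int[of n] by auto
    finally have "(LINT x|M. d n x) = (LINT x|M. ?m (Suc n) x) - (LINT x|M. ?m n x)" .
    moreover have "(LINT x|M. ?m n x) \<le> (LINT x|M. ?m (Suc n) x)"
      by (intro integral_mono m_int max_orbit_sum_Suc_ge)
    ultimately show ?thesis by linarith
  qed
  have "(\<lambda>n. LINT x|M. d n x) \<longlonglongrightarrow> (LINT x|M. G x)"
  proof (rule integral_dominated_convergence[where w = "\<lambda>x. \<bar>G x\<bar>"])
    show "AE x in M. (\<lambda>n. d n x) \<longlonglongrightarrow> G x"
      using ae
    proof eventually_elim
      case (elim x)
      then have "T x \<in> unbounded_orbit_sums G"
        using unbounded_orbit_sums_invariant[of G] by auto
      moreover obtain b :: nat where b: "\<bar>G x\<bar> \<le> real b"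
        using real_arch_simple by blast
      ultimately obtain n0 where n0: "real b < ?m n0 (T x)"
        unfolding unbounded_orbit_sums_def by auto
      have "d n x = G x" if "n \<ge> n0" for n
        using max_orbit_sum_mono[OF that, of G "T x"] n0 b unfolding d_eq by auto
      then show ?case
        by (intro tendsto_eventually eventually_sequentiallyI)
    qed
    show "AE x in M. norm (d n x) \<le> \<bar>G x\<bar>" for n
      using max_orbit_sum_nonneg[of G n] by (auto simp: d_eq max_def)
  qed (use G d_meas in auto)
  then show ?thesis
    using nonneg by (intro LIMSEQ_le_const) auto
qed

end

context weakly_mixing_system
begin

text \<open>Weak mixing applied to the pair \<open>E\<close>, \<open>E\<close> averages the constant \<open>\<bar>\<mu>(E) - \<mu>(E)\<^sup>2\<bar>\<close>.\<close>

lemma invariant_set_trivial: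
  assumes E: "E \<in> sets M" and inv: "T -` E \<inter> space M = E"
  shows "measure M E = 0 \<or> measure M E = 1"
proof -
  have ev: "(T ^^ n) -` E \<inter> space M = E" for n
  proof (induction n)
    case 0
    show ?case using sets.sets_into_space[OF E] by auto
  next
    case (Suc n)
    have "(T ^^ Suc n) -` E \<inter> space M = (T ^^ n) -` (T -` E \<inter> space M) \<inter> space M"
      using measurable_space[OF measurable_funpow[of n]] by auto
    then show ?case by (simp only: inv Suc)
  qed
  let ?a = "\<bar>measure M E - measure M E * measure M E\<bar>"
  have "(\<lambda>N::nat. (\<Sum>n=1..N. ?a) / real N) \<longlonglongrightarrow> 0"
    using weakly_mixing[OF E E] by (simp add: ev)
  moreover have "(\<lambda>N::nat. (\<Sum>n=1..N. ?a) / real N) \<longlonglongrightarrow> ?a"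
    by (intro tendsto_eventually eventually_sequentiallyI[of 1]) auto
  ultimately have "?a = 0" by (rule LIMSEQ_unique[symmetric])
  then have "measure M E * (1 - measure M E) = 0" by (simp add: algebra_simps)
  then show ?thesis by auto
qed

text \<open>The set of unboundedness is invariant, hence null or full, and the sign of the integral
  excludes the second case.\<close>

lemma orbit_sums_bounded_above:
  fixes G :: "'a \<Rightarrow> real"
  assumes G: "integrable M G" and neg: "(LINT x|M. G x) < 0"
  shows "AE x in M. \<exists>B. \<forall>N. (\<Sum>n=1..N. G ((T ^^ n) x)) \<le> B"
proof -
  let ?E = "unbounded_orbit_sums G"
  have E: "?E \<in> sets M" by (rule sets_unbounded_orbit_sums[OF G])
  have "measure M ?E \<noteq> 1"
    using integral_nonneg_if_unbounded_orbit_sums[OF G] neg prob_eq_1[OF E] by auto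
  then have "measure M ?E = 0"
    using invariant_set_trivial[OF E unbounded_orbit_sums_invariant] by blast
  then have "AE x in M. x \<notin> ?E"
    using prob_eq_0[OF E] by simp
  moreover have "AE x in M. x \<in> space M" by simp
  ultimately show ?thesis
  proof eventually_elim
    case (elim x)
    then obtain b :: nat where b: "\<And>n. max_orbit_sum G n x \<le> real b"
      unfolding unbounded_orbit_sums_def by (auto simp: not_less)
    have "(\<Sum>n=1..N. G ((T ^^ n) x)) \<le> real b - G x" for N
      using orbit_sum_le_max_orbit_sum[of G x N] b[of "Suc N"] by linarith
    then show ?case by blast
  qed
qed

lemma orbit_averages_eventually_le:
  fixes F :: "'a \<Rightarrow> real"
  assumes F: "integrable M F"
  shows "AE x in M. \<forall>a > (LINT x|M. F x).
           eventually (\<lambda>N. (\<Sum>n=1..N. F ((T ^^ n) x)) \<le> a * real N) sequentially"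
proof -
  let ?I = "LINT x|M. F x"
  \<comment> \<open>Subtracting slightly more than the mean makes the integral negative; countably many
      margins \<open>e k\<close> suffice.\<close>
  define e where "e k = 1 / real (Suc k)" for k
  have e_pos: "e k > 0" for k by (simp add: e_def)
  have "AE x in M. \<forall>k. \<exists>B. \<forall>N. (\<Sum>n=1..N. F ((T ^^ n) x) - (?I + e k)) \<le> B"
    unfolding AE_all_countable
  proof
    fix k
    show "AE x in M. \<exists>B. \<forall>N. (\<Sum>n=1..N. F ((T ^^ n) x) - (?I + e k)) \<le> B"
    proof (rule orbit_sums_bounded_above)
      show "integrable M (\<lambda>x. F x - (?I + e k))" using F by simp
      have "(LINT x|M. F x - (?I + e k)) = ?I - (?I + e k)"
        using F by (simp add: prob_space)
      then show "(LINT x|M. F x - (?I + e k)) < 0" using e_pos[of k] by simp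
    qed
  qed
  then show ?thesis
  proof eventually_elim
    case (elim x)
    show ?case
    proof (intro allI impI)
      fix a assume "?I < a"
      then obtain k where k: "e k < a - ?I"
        using reals_Archimedean[of "a - ?I"] unfolding e_def by (auto simp: inverse_eq_divide)
      obtain B where B: "\<And>N. (\<Sum>n=1..N. F ((T ^^ n) x) - (?I + e k)) \<le> B"
        using elim by blast
      define t where "t = a - ?I - e k"
      have t: "t > 0" using k by (simp add: t_def)
      obtain N0 :: nat where N0: "B / t \<le> real N0"
        using real_arch_simple by blast
      have "(\<Sum>n=1..N. F ((T ^^ n) x)) \<le> a * real N" if N: "N \<ge> N0" for N
      proof -
        have "B / t \<le> real N" using N0 N by linarith
        then have "B \<le> t * real N" using t by (simp add: field_simps)
        then have "(\<Sum>n=1..N. F ((T ^^ n) x)) - real N * (?I + e k) \<le> t * real N"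
          using B[of N] by (simp add: sum_subtractf)
        then show ?thesis by (simp add: t_def algebra_simps)
      qed
      then show "eventually (\<lambda>N. (\<Sum>n=1..N. F ((T ^^ n) x)) \<le> a * real N) sequentially"
        by (rule eventually_sequentiallyI)
    qed
  qed
qed

end

section \<open>Weighted ergodic averages vanish in mean\<close>

text \<open>For a given \<open>h\<close>, each distance to \<open>h\<close> is attained by at most two values of \<open>k\<close>, one on
  either side.\<close>

lemma double_sum_difference_le:
  fixes r :: "nat \<Rightarrow> real"
  assumes "\<And>m. r m \<ge> 0"
  shows "(\<Sum>h=1..H. \<Sum>k=1..H. r (if h \<le> k then k - h else h - k)) \<le> 2 * real H * (\<Sum>m=0..H. r m)"
proof -
  have "(\<Sum>k=1..H. r (if h \<le> k then k - h else h - k)) \<le> 2 * (\<Sum>m=0..H. r m)"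
    if h: "h \<in> {1..H}" for h
  proof -
    let ?g = "\<lambda>k. r (if h \<le> k then k - h else h - k)"
    have split: "{1..H} = {1..<h} \<union> {h..H}" using h by auto
    have "(\<Sum>k=1..H. ?g k) = (\<Sum>k\<in>{1..<h}. ?g k) + (\<Sum>k\<in>{h..H}. ?g k)"
      unfolding split by (rule sum.union_disjoint) auto
    moreover have "(\<Sum>k\<in>{1..<h}. ?g k) \<le> (\<Sum>m=0..H. r m)"
    proof -
      have "(\<Sum>k\<in>{1..<h}. ?g k) = (\<Sum>k\<in>{1..<h}. r (h - k))" by (intro sum.cong) auto
      also have "\<dots> = (\<Sum>m\<in>(\<lambda>k. h - k) ` {1..<h}. r m)"
        by (subst sum.reindex) (auto simp: inj_on_def)
      also have "\<dots> \<le> (\<Sum>m=0..H. r m)"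
        using h assms by (intro sum_mono2) auto
      finally show ?thesis .
    qed
    moreover have "(\<Sum>k\<in>{h..H}. ?g k) \<le> (\<Sum>m=0..H. r m)"
    proof -
      have "(\<Sum>k\<in>{h..H}. ?g k) = (\<Sum>k\<in>{h..H}. r (k - h))" by (intro sum.cong) auto
      also have "\<dots> = (\<Sum>m\<in>(\<lambda>k. k - h) ` {h..H}. r m)"
        by (subst sum.reindex) (auto simp: inj_on_def)
      also have "\<dots> \<le> (\<Sum>m=0..H. r m)"
        using assms by (intro sum_mono2) auto
      finally show ?thesis .
    qed
    ultimately show ?thesis by linarith
  qed
  then have "(\<Sum>h=1..H. \<Sum>k=1..H. r (if h \<le> k then k - h else h - k))
      \<le> (\<Sum>h=1..H. 2 * (\<Sum>m=0..H. r m))"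
    by (rule sum_mono)
  then show ?thesis by simp
qed

context measure_preserving_system
begin

text \<open>The second moment expands into correlations, which by invariance depend on the time
  difference only.\<close>

lemma weighted_indicator_second_moment_le:
  fixes c :: "nat \<Rightarrow> real"
  assumes A: "A \<in> sets M" and c: "\<And>h. \<bar>c h\<bar> \<le> 1"
  defines "r \<equiv> \<lambda>m. \<bar>measure M (A \<inter> ((T ^^ m) -` A \<inter> space M)) - measure M A * measure M A\<bar>"
  shows "(LINT x|M. (\<Sum>h=1..H. c h * (indicator A ((T ^^ h) x) - measure M A))\<^sup>2)
           \<le> 2 * real H * (\<Sum>m=0..H. r m)"
proof -
  note [measurable] = A
  define D where "D h x = indicator A ((T ^^ h) x) - measure M A" for h x
  define B where "B h = (T ^^ h) -` A \<inter> space M" for h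
  have B [measurable]: "B h \<in> sets M" for h unfolding B_def by measurable
  have mB: "measure M (B h) = measure M A" for h unfolding B_def by (rule measure_funpow[OF A])
  have int_ind: "integrable M (\<lambda>x. indicator S x :: real)" if "S \<in> sets M" for S
    using that by (simp add: integrable_indicator_iff emeasure_eq_measure)
  have D_eq: "D h x * D k x = indicator (B h \<inter> B k) x - measure M A * indicator (B h) x
      - measure M A * indicator (B k) x + measure M A * measure M A" if "x \<in> space M" for h k x
    using that by (auto simp: D_def B_def indicator_def algebra_simps)
  have int_rhs: "integrable M (\<lambda>x. indicator (B h \<inter> B k) x - measure M A * indicator (B h) x
      - measure M A * indicator (B k) x + measure M A * measure M A)" for h k
    by (intro Bochner_Integration.integrable_add Bochner_Integration.integrable_diff
        integrable_mult_right int_ind) auto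
  have D_int: "integrable M (\<lambda>x. D h x * D k x)" for h k
    using int_rhs[of h k] by (subst Bochner_Integration.integrable_cong[OF refl D_eq])
  have corr: "(LINT x|M. D h x * D k x) = measure M (B h \<inter> B k) - measure M A * measure M A" for h k
  proof -
    have "(LINT x|M. D h x * D k x) = (LINT x|M. indicator (B h \<inter> B k) x - measure M A * indicator (B h) x
      - measure M A * indicator (B k) x + measure M A * measure M A)"
      by (rule Bochner_Integration.integral_cong[OF refl D_eq])
    also have "\<dots> = measure M (B h \<inter> B k) - measure M A * measure M (B h)
        - measure M A * measure M (B k) + measure M A * measure M A"
      using int_ind[OF B[of h]] int_ind[OF B[of k]] int_ind[of "B h \<inter> B k"]
      by (simp add: prob_space)
    finally show ?thesis by (simp add: mB)
  qed
  have shift: "measure M (B h \<inter> B k) = measure M (A \<inter> ((T ^^ (k - h)) -` A \<inter> space M))"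
    if "h \<le> k" for h k
  proof -
    have "B h \<inter> B k = (T ^^ h) -` (A \<inter> ((T ^^ (k - h)) -` A \<inter> space M)) \<inter> space M"
    proof -
      have "(T ^^ k) x = (T ^^ (k - h)) ((T ^^ h) x)" for x
        using that by (metis comp_apply funpow_add le_add_diff_inverse2)
      then show ?thesis
        using measurable_space[OF measurable_funpow[of h]] unfolding B_def by auto
    qed
    moreover have "A \<inter> ((T ^^ (k - h)) -` A \<inter> space M) \<in> sets M" by measurable
    ultimately show ?thesis by (simp only: measure_funpow)
  qed
  have corr_r: "\<bar>LINT x|M. D h x * D k x\<bar> = r (if h \<le> k then k - h else h - k)" for h k
    using shift[of h k] shift[of k h] by (auto simp: corr r_def Int_commute)
  have "(LINT x|M. (\<Sum>h=1..H. c h * D h x)\<^sup>2)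
      = (LINT x|M. (\<Sum>h=1..H. \<Sum>k=1..H. c h * c k * (D h x * D k x)))"
    by (simp add: power2_eq_square sum_product mult_ac)
  also have "\<dots> = (\<Sum>h=1..H. \<Sum>k=1..H. c h * c k * (LINT x|M. D h x * D k x))"
    using D_int by (simp add: Bochner_Integration.integral_sum)
  also have "\<dots> \<le> (\<Sum>h=1..H. \<Sum>k=1..H. r (if h \<le> k then k - h else h - k))"
  proof (intro sum_mono)
    fix h k
    have "c h * c k * (LINT x|M. D h x * D k x) \<le> \<bar>c h\<bar> * \<bar>c k\<bar> * \<bar>LINT x|M. D h x * D k x\<bar>"
      by (metis abs_ge_self abs_mult)
    also have "\<dots> \<le> 1 * \<bar>LINT x|M. D h x * D k x\<bar>"
      using c[of h] c[of k] by (intro mult_right_mono mult_le_one) auto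
    finally show "c h * c k * (LINT x|M. D h x * D k x) \<le> r (if h \<le> k then k - h else h - k)"
      by (simp add: corr_r)
  qed
  also have "\<dots> \<le> 2 * real H * (\<Sum>m=0..H. r m)"
    by (rule double_sum_difference_le) (simp add: r_def)
  finally show ?thesis by (simp add: D_def)
qed

text \<open>The uniformity over all bounded weights is what later allows the signs of the
  correlations \<open>l h\<close> to be inserted. The mean is subtracted inside the definition so that
  indicators, with which the approximation starts, are admitted.\<close>

definition L1_averages_vanish :: "('a \<Rightarrow> 'b::{banach, second_countable_topology}) \<Rightarrow> bool" where
  "L1_averages_vanish f \<longleftrightarrow> (\<forall>\<epsilon>>0. eventually (\<lambda>H. \<forall>c::nat \<Rightarrow> real. (\<forall>h. \<bar>c h\<bar> \<le> 1) \<longrightarrow>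
     (LINT x|M. norm (\<Sum>h=1..H. c h *\<^sub>R (f ((T ^^ h) x) - (LINT x|M. f x)))) \<le> \<epsilon> * real H) sequentially)"

lemma integrable_weighted_sum:
  fixes f :: "'a \<Rightarrow> 'b::{banach, second_countable_topology}"
  assumes "integrable M f"
  shows "integrable M (\<lambda>x. \<Sum>h=1..H. (c h :: real) *\<^sub>R (f ((T ^^ h) x) - m))"
  using integrable_funpow[OF assms] by simp

lemma L1_averages_vanish_add:
  fixes f g :: "'a \<Rightarrow> 'b::{banach, second_countable_topology}"
  assumes f: "integrable M f" "L1_averages_vanish f"
    and g: "integrable M g" "L1_averages_vanish g"
  shows "L1_averages_vanish (\<lambda>x. f x + g x)"
  unfolding L1_averages_vanish_def
proof (intro allI impI)
  fix \<epsilon> :: real assume "\<epsilon> > 0"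
  then have e: "\<epsilon> / 2 > 0" by simp
  let ?S = "\<lambda>f H c x. \<Sum>h=1..H. (c h :: real) *\<^sub>R (f ((T ^^ h) x) - (LINT x|M. f x))"
  have add: "?S (\<lambda>x. f x + g x) H c x = ?S f H c x + ?S g H c x" for H c x
    using f g by (simp add: sum.distrib[symmetric] algebra_simps)
  show "eventually (\<lambda>H. \<forall>c. (\<forall>h. \<bar>c h\<bar> \<le> 1) \<longrightarrow>
     (LINT x|M. norm (?S (\<lambda>x. f x + g x) H c x)) \<le> \<epsilon> * real H) sequentially"
    using f(2)[unfolded L1_averages_vanish_def, rule_format, OF e]
      g(2)[unfolded L1_averages_vanish_def, rule_format, OF e]
  proof eventually_elim
    case (elim H)
    show ?case
    proof (intro allI impI)
      fix c :: "nat \<Rightarrow> real" assume c: "\<forall>h. \<bar>c h\<bar> \<le> 1"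
      have i: "integrable M (?S f H c)" "integrable M (?S g H c)"
        by (intro integrable_weighted_sum f g)+
      have "(LINT x|M. norm (?S (\<lambda>x. f x + g x) H c x))
          \<le> (LINT x|M. norm (?S f H c x) + norm (?S g H c x))"
        unfolding add using i by (intro integral_mono) (auto intro: norm_triangle_ineq)
      also have "\<dots> = (LINT x|M. norm (?S f H c x)) + (LINT x|M. norm (?S g H c x))"
        using i by (intro Bochner_Integration.integral_add integrable_norm)
      also have "\<dots> \<le> \<epsilon> / 2 * real H + \<epsilon> / 2 * real H"
        using elim c by (intro add_mono) blast+
      finally show "(LINT x|M. norm (?S (\<lambda>x. f x + g x) H c x)) \<le> \<epsilon> * real H" by simp
    qed
  qed
qed

text \<open>Averaging contracts the \<open>L\<^sup>1\<close>-norm, so a small perturbation of the function perturbs all the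
  weighted averages by a comparable amount, independently of \<open>H\<close> and the weights.\<close>

lemma L1_averages_vanish_limit:
  fixes f :: "'a \<Rightarrow> 'b::{banach, second_countable_topology}"
  assumes f: "integrable M f"
    and s: "\<And>i. integrable M (s i)" "\<And>i. L1_averages_vanish (s i)"
    and lim: "(\<lambda>i. LINT x|M. norm (s i x - f x)) \<longlonglongrightarrow> 0"
  shows "L1_averages_vanish f"
  unfolding L1_averages_vanish_def
proof (intro allI impI)
  fix \<epsilon> :: real assume e: "\<epsilon> > 0"
  then obtain i where i: "(LINT x|M. norm (s i x - f x)) < \<epsilon> / 4"
    using order_tendstoD(2)[OF lim, of "\<epsilon> / 4"] unfolding eventually_sequentially by auto
  define \<delta> where "\<delta> = (LINT x|M. norm (s i x - f x))"
  define p where "p x = s i x - f x" for x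
  have p: "integrable M p" unfolding p_def using f s by simp
  let ?S = "\<lambda>f H c x. \<Sum>h=1..H. (c h :: real) *\<^sub>R (f ((T ^^ h) x) - (LINT x|M. f x))"
  have diff: "?S f H c x = ?S (s i) H c x - ?S p H c x" for H c x
    using f s unfolding p_def by (simp add: sum_subtractf[symmetric] algebra_simps)
  have p_bound: "(LINT x|M. norm (?S p H c x)) \<le> \<epsilon> / 2 * real H"
    if c: "\<forall>h. \<bar>c h\<bar> \<le> 1" for H c
  proof -
    let ?m = "LINT x|M. p x"
    have pn: "integrable M (\<lambda>x. norm (p ((T ^^ h) x)))" for h
      using integrable_funpow[OF p] by simp
    have "norm (?S p H c x) \<le> (\<Sum>h=1..H. norm (p ((T ^^ h) x)) + norm ?m)" for x
    proof (rule sum_norm_le)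
      fix h
      have "norm (c h *\<^sub>R (p ((T ^^ h) x) - ?m)) \<le> 1 * norm (p ((T ^^ h) x) - ?m)"
        unfolding norm_scaleR using c by (intro mult_right_mono) auto
      also have "\<dots> \<le> norm (p ((T ^^ h) x)) + norm ?m" by (simp add: norm_triangle_ineq4)
      finally show "norm (c h *\<^sub>R (p ((T ^^ h) x) - ?m)) \<le> norm (p ((T ^^ h) x)) + norm ?m" .
    qed
    then have "(LINT x|M. norm (?S p H c x)) \<le> (LINT x|M. (\<Sum>h=1..H. norm (p ((T ^^ h) x)) + norm ?m))"
      using integrable_weighted_sum[OF p] pn by (intro integral_mono) auto
    also have "\<dots> = (\<Sum>h=1..H. (LINT x|M. norm (p ((T ^^ h) x))) + norm ?m)"
      using pn by (simp add: Bochner_Integration.integral_sum prob_space)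
    also have "\<dots> = (\<Sum>h=1..H. \<delta> + norm ?m)"
      using integral_funpow[of "\<lambda>x. norm (p x)"] p unfolding \<delta>_def p_def[symmetric] by simp
    also have "norm ?m \<le> \<delta>" unfolding \<delta>_def p_def by (rule integral_norm_bound)
    then have "(\<Sum>h=1..H. \<delta> + norm ?m) \<le> (\<Sum>h=1..H. \<epsilon> / 2)"
      using i by (intro sum_mono) (simp add: \<delta>_def)
    finally show ?thesis by (simp add: mult.commute)
  qed
  have e2: "\<epsilon> / 2 > 0" using e by simp
  show "eventually (\<lambda>H. \<forall>c. (\<forall>h. \<bar>c h\<bar> \<le> 1) \<longrightarrow>
     (LINT x|M. norm (?S f H c x)) \<le> \<epsilon> * real H) sequentially"
    using s(2)[of i, unfolded L1_averages_vanish_def, rule_format, OF e2]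
  proof eventually_elim
    case (elim H)
    show ?case
    proof (intro allI impI)
      fix c :: "nat \<Rightarrow> real" assume c: "\<forall>h. \<bar>c h\<bar> \<le> 1"
      have int: "integrable M (?S (s i) H c)" "integrable M (?S p H c)"
        by (intro integrable_weighted_sum p s)+
      have "(LINT x|M. norm (?S f H c x))
          \<le> (LINT x|M. norm (?S (s i) H c x) + norm (?S p H c x))"
        unfolding diff using int by (intro integral_mono) (auto intro: norm_triangle_ineq4)
      also have "\<dots> = (LINT x|M. norm (?S (s i) H c x)) + (LINT x|M. norm (?S p H c x))"
        using int by (intro Bochner_Integration.integral_add integrable_norm)
      also have "\<dots> \<le> \<epsilon> / 2 * real H + \<epsilon> / 2 * real H"
        using elim c by (intro add_mono p_bound) blast+
      finally show "(LINT x|M. norm (?S f H c x)) \<le> \<epsilon> * real H" by simp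
    qed
  qed
qed

end

context weakly_mixing_system
begin

lemma L1_averages_vanish_indicator:
  fixes z :: "'b::{banach, second_countable_topology}"
  assumes A: "A \<in> sets M"
  shows "L1_averages_vanish (\<lambda>x. indicator A x *\<^sub>R z)"
  unfolding L1_averages_vanish_def
proof (intro allI impI)
  fix \<epsilon> :: real assume e: "\<epsilon> > 0"
  note [measurable] = A
  define r where "r m = \<bar>measure M (A \<inter> ((T ^^ m) -` A \<inter> space M)) - measure M A * measure M A\<bar>" for m
  define R where "R H = (\<Sum>m=0..H. r m)" for H
  have int_z: "(LINT x|M. indicator A x *\<^sub>R z) = measure M A *\<^sub>R z"
    by (simp add: emeasure_eq_measure)
  have "(\<lambda>H. r 0 / real H + (\<Sum>m=1..H. r m) / real H) \<longlonglongrightarrow> 0 + 0"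
    using weakly_mixing[OF A A] unfolding r_def
    by (intro tendsto_add lim_const_over_n) auto
  moreover have "r 0 / real H + (\<Sum>m=1..H. r m) / real H = R H / real H" for H
    by (simp add: R_def sum.atLeast_Suc_atMost add_divide_distrib)
  ultimately have "(\<lambda>H. R H / real H) \<longlonglongrightarrow> 0" by simp
  \<comment> \<open>Adding one keeps the denominator positive when \<open>z = 0\<close>.\<close>
  define \<eta> where "\<eta> = \<epsilon> / (norm z + 1)"
  have \<eta>: "\<eta> > 0" "\<eta> * norm z \<le> \<epsilon>"
    using e by (auto simp: \<eta>_def field_simps add_pos_nonneg)
  have ev: "eventually (\<lambda>H. R H / real H < \<eta>\<^sup>2 / 2) sequentially"
    using \<open>(\<lambda>H. R H / real H) \<longlonglongrightarrow> 0\<close> \<eta> by (intro order_tendstoD) auto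
  let ?f = "\<lambda>x. indicator A x *\<^sub>R z"
  show "eventually (\<lambda>H. \<forall>c. (\<forall>h. \<bar>c h\<bar> \<le> 1) \<longrightarrow>
     (LINT x|M. norm (\<Sum>h=1..H. (c h::real) *\<^sub>R (?f ((T ^^ h) x) - (LINT x|M. ?f x)))) \<le> \<epsilon> * real H) sequentially"
    using ev eventually_ge_at_top[of "1::nat"]
  proof eventually_elim
    case (elim H)
    show ?case
    proof (intro allI impI)
      fix c :: "nat \<Rightarrow> real" assume c: "\<forall>h. \<bar>c h\<bar> \<le> 1"
      define X where "X x = (\<Sum>h=1..H. c h * (indicator A ((T ^^ h) x) - measure M A))" for x
      have X_meas [measurable]: "X \<in> borel_measurable M"
        unfolding X_def by measurable
      have X_bound: "\<bar>X x\<bar> \<le> real H" for x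
      proof -
        have "\<bar>X x\<bar> \<le> (\<Sum>h=1..H. \<bar>c h * (indicator A ((T ^^ h) x) - measure M A)\<bar>)"
          unfolding X_def by (rule sum_abs)
        also have "\<dots> \<le> (\<Sum>h=1..H. 1)"
        proof (rule sum_mono)
          fix h
          have ind: "0 \<le> indicat_real A ((T ^^ h) x)" "indicat_real A ((T ^^ h) x) \<le> 1"
            by (auto simp: indicator_def)
          have "\<bar>indicator A ((T ^^ h) x) - measure M A\<bar> \<le> 1"
            using prob_le_1[of A] measure_nonneg[of M A] ind by linarith
          then show "\<bar>c h * (indicator A ((T ^^ h) x) - measure M A)\<bar> \<le> 1"
            unfolding abs_mult using c by (intro mult_le_one) auto
        qed
        finally show ?thesis by simp
      qed
      have X_int: "integrable M (\<lambda>x. \<bar>X x\<bar>)"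
        by (rule integrable_const_bound[where B = "real H"]) (auto simp: X_bound)
      have X2_int: "integrable M (\<lambda>x. \<bar>X x\<bar>\<^sup>2)"
      proof (rule integrable_const_bound[where B = "(real H)\<^sup>2"])
        show "AE x in M. norm (\<bar>X x\<bar>\<^sup>2) \<le> (real H)\<^sup>2"
          using X_bound by (auto simp: abs_le_square_iff[symmetric])
      qed auto
      \<comment> \<open>Nonnegativity of the variance of \<open>\<bar>X\<bar>\<close> passes from the second moment to the first.\<close>
      have "(LINT x|M. \<bar>X x\<bar>)\<^sup>2 \<le> (LINT x|M. \<bar>X x\<bar>\<^sup>2)"
        using variance_eq[OF X_int X2_int] variance_positive[of "\<lambda>x. \<bar>X x\<bar>"] by simp
      also have "\<dots> \<le> 2 * real H * R H"
        using weighted_indicator_second_moment_le[OF A, of c H] c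
        unfolding X_def R_def r_def by simp
      also have "\<dots> \<le> (\<eta> * real H)\<^sup>2"
        using elim by (simp add: field_simps power2_eq_square)
      finally have "(LINT x|M. \<bar>X x\<bar>) \<le> \<eta> * real H"
        by (rule power2_le_imp_le) (use \<eta> in auto)
      have "(\<Sum>h=1..H. c h *\<^sub>R (?f ((T ^^ h) x) - (LINT x|M. ?f x))) = X x *\<^sub>R z" for x
        unfolding int_z X_def by (simp add: scaleR_sum_left scaleR_diff_left[symmetric])
      then have "(LINT x|M. norm (\<Sum>h=1..H. c h *\<^sub>R (?f ((T ^^ h) x) - (LINT x|M. ?f x))))
          = (LINT x|M. \<bar>X x\<bar>) * norm z"
        by simp
      also have "\<dots> \<le> (\<eta> * real H) * norm z"
        using \<open>(LINT x|M. \<bar>X x\<bar>) \<le> \<eta> * real H\<close> by (rule mult_right_mono) simp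
      also have "\<dots> \<le> \<epsilon> * real H"
        using mult_right_mono[OF \<eta>(2), of "real H"] by (simp add: mult_ac)
      finally show "(LINT x|M. norm (\<Sum>h=1..H. c h *\<^sub>R (?f ((T ^^ h) x) - (LINT x|M. ?f x))))
          \<le> \<epsilon> * real H" .
    qed
  qed
qed

lemma weighted_averages_L1_small:
  fixes f :: "'a \<Rightarrow> 'b::{banach, second_countable_topology}"
  assumes "integrable M f"
  shows "L1_averages_vanish f"
  using assms
proof (induction rule: integrable_induct)
  case (base A z)
  then show ?case by (intro L1_averages_vanish_indicator)
next
  case (add f g)
  then show ?case by (intro L1_averages_vanish_add)
next
  case (lim f s)
  have "(\<lambda>i. LINT x|M. norm (s i x - f x)) \<longlonglongrightarrow> (LINT x|M. 0)"
  proof (rule integral_dominated_convergence[where w = "\<lambda>x. 3 * norm (f x)"])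
    show "AE x in M. (\<lambda>i. norm (s i x - f x)) \<longlonglongrightarrow> 0"
      using lim.hyps by (auto intro!: AE_I2 tendsto_norm_zero LIM_zero)
    show "AE x in M. norm (norm (s i x - f x)) \<le> 3 * norm (f x)" for i
    proof (rule AE_I2)
      fix x assume x: "x \<in> space M"
      have "norm (s i x - f x) \<le> norm (s i x) + norm (f x)" by (rule norm_triangle_ineq4)
      then show "norm (norm (s i x - f x)) \<le> 3 * norm (f x)"
        using lim.hyps(3)[OF x, of i] by simp
    qed
  qed (use lim.hyps in auto)
  then show ?case
    using lim by (intro L1_averages_vanish_limit[of f s]) auto
qed

end

section \<open>From sign patterns to weakly mixing sequences\<close>

text \<open>The sign pattern that is positive exactly on \<open>S\<close>.\<close>

definition sign_on :: "nat set \<Rightarrow> nat \<Rightarrow> real" where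
  "sign_on S h = (if h \<in> S then 1 else - 1)"

text \<open>Real and imaginary parts are treated with one sign pattern each; this costs a factor two
  and avoids approximating arbitrary unimodular weights.\<close>

lemma sum_cmod_le_sign_patterns:
  fixes l :: "nat \<Rightarrow> complex"
  assumes "\<And>S. S \<subseteq> {1..H} \<Longrightarrow> cmod (\<Sum>h=1..H. sign_on S h *\<^sub>R l h) \<le> B"
  shows "(\<Sum>h=1..H. cmod (l h)) \<le> 2 * B"
proof -
  define P where "P = {h \<in> {1..H}. Re (l h) \<ge> 0}"
  define Q where "Q = {h \<in> {1..H}. Im (l h) \<ge> 0}"
  have "(\<Sum>h=1..H. \<bar>Re (l h)\<bar>) = Re (\<Sum>h=1..H. sign_on P h *\<^sub>R l h)"
    by (auto simp: Re_sum sign_on_def P_def intro!: sum.cong)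
  also have "\<dots> \<le> B"
    by (rule order_trans[OF complex_Re_le_cmod assms]) (auto simp: P_def)
  finally have re: "(\<Sum>h=1..H. \<bar>Re (l h)\<bar>) \<le> B" .
  have "(\<Sum>h=1..H. \<bar>Im (l h)\<bar>) = Im (\<Sum>h=1..H. sign_on Q h *\<^sub>R l h)"
    by (auto simp: Im_sum sign_on_def Q_def intro!: sum.cong)
  also have "\<dots> \<le> cmod (\<Sum>h=1..H. sign_on Q h *\<^sub>R l h)"
    using abs_Im_le_cmod abs_le_D1 by blast
  also have "\<dots> \<le> B" by (rule assms) (auto simp: Q_def)
  finally have im: "(\<Sum>h=1..H. \<bar>Im (l h)\<bar>) \<le> B" .
  have "(\<Sum>h=1..H. cmod (l h)) \<le> (\<Sum>h=1..H. \<bar>Re (l h)\<bar> + \<bar>Im (l h)\<bar>)"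
    by (intro sum_mono cmod_le)
  then show ?thesis using re im by (simp add: sum.distrib)
qed

text \<open>A sequence is weakly mixing as soon as its signed block sums are small on average,
  uniformly in the signs: pairing with \<open>y\<close> and exchanging the finite sum over \<open>h\<close> with the limit
  along \<open>Nq\<close> bounds every signed sum of the correlations.\<close>

lemma weakly_mixing_sequenceI:
  fixes x :: "nat \<Rightarrow> complex"
  assumes bdd: "limsup (\<lambda>N::nat. ereal ((\<Sum>n=1..N. cmod (x n)) / real N)) < \<infinity>"
    and blocks: "\<And>\<epsilon>. \<epsilon> > 0 \<Longrightarrow> eventually (\<lambda>H. \<forall>S\<subseteq>{1..H}. eventually (\<lambda>N.
        (\<Sum>n=1..N. cmod (\<Sum>h=1..H. sign_on S h *\<^sub>R x (n + h))) \<le> \<epsilon> * real H * real N) sequentially) sequentially"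
  shows "weakly_mixing_sequence x"
  unfolding weakly_mixing_sequence_def
proof (intro conjI allI impI bdd)
  fix y :: "nat \<Rightarrow> complex" and Nq :: "nat \<Rightarrow> nat" and l :: "nat \<Rightarrow> complex"
  assume y: "bounded (y ` {1..})" and mono: "strict_mono_on {1..} Nq"
    and pos: "\<forall>q\<ge>1. 1 \<le> Nq q"
    and l: "\<forall>h\<ge>1. (\<lambda>q. (\<Sum>n=1..Nq q. x (n + h) * cnj (y n)) / of_nat (Nq q)) \<longlonglongrightarrow> l h"
  obtain K where K: "K > 0" "\<And>n. n \<ge> 1 \<Longrightarrow> cmod (y n) \<le> K"
    using y unfolding bounded_pos by auto
  have Nq_ge: "q \<le> Nq q" if "q \<ge> 1" for q
    using that
  proof (induction q rule: nat_induct_at_least)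
    case base
    show ?case using pos by simp
  next
    case (Suc q)
    have "Nq q < Nq (Suc q)" using mono Suc.hyps by (intro strict_mono_onD[OF mono]) auto
    then show ?case using Suc by simp
  qed
  have Nq_top: "filterlim Nq sequentially sequentially"
    by (rule filterlim_at_top_mono[OF filterlim_ident])
       (auto intro!: eventually_sequentiallyI[of 1] Nq_ge)
  have main: "eventually (\<lambda>H. (\<Sum>h=1..H. cmod (l h)) / real H \<le> \<epsilon>) sequentially"
    if e: "\<epsilon> > 0" for \<epsilon>
  proof -
    have e': "\<epsilon> / (2 * K) > 0" using e K by simp
    show ?thesis
      using blocks[OF e'] eventually_ge_at_top[of "1::nat"]
    proof eventually_elim
      case (elim H)
      have "cmod (\<Sum>h=1..H. sign_on S h *\<^sub>R l h) \<le> \<epsilon> / 2 * real H" if S: "S \<subseteq> {1..H}" for S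
      proof -
        define w where "w n = (\<Sum>h=1..H. sign_on S h *\<^sub>R x (n + h))" for n
        let ?c = "\<lambda>q. (\<Sum>n=1..Nq q. w n * cnj (y n)) / of_nat (Nq q)"
        have "(\<lambda>q. \<Sum>h=1..H. sign_on S h *\<^sub>R ((\<Sum>n=1..Nq q. x (n + h) * cnj (y n)) / of_nat (Nq q)))
            \<longlonglongrightarrow> (\<Sum>h=1..H. sign_on S h *\<^sub>R l h)"
          using l by (intro tendsto_sum tendsto_scaleR tendsto_const) auto
        moreover have "(\<Sum>h=1..H. sign_on S h *\<^sub>R ((\<Sum>n=1..Nq q. x (n + h) * cnj (y n)) / of_nat (Nq q)))
            = ?c q" for q
        proof -
          have "(\<Sum>n=1..Nq q. w n * cnj (y n))
              = (\<Sum>n=1..Nq q. \<Sum>h=1..H. sign_on S h *\<^sub>R (x (n + h) * cnj (y n)))"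
            unfolding w_def by (simp add: sum_distrib_right)
          also have "\<dots> = (\<Sum>h=1..H. \<Sum>n=1..Nq q. sign_on S h *\<^sub>R (x (n + h) * cnj (y n)))"
            by (rule sum.swap)
          finally show ?thesis
            by (simp add: sum_divide_distrib scaleR_sum_right sum_distrib_left
                scaleR_conv_of_real)
        qed
        ultimately have "?c \<longlonglongrightarrow> (\<Sum>h=1..H. sign_on S h *\<^sub>R l h)" by simp
        then have "(\<lambda>q. cmod (?c q)) \<longlonglongrightarrow> cmod (\<Sum>h=1..H. sign_on S h *\<^sub>R l h)"
          by (rule tendsto_norm)
        moreover have "eventually (\<lambda>q. cmod (?c q) \<le> \<epsilon> / 2 * real H) sequentially"
        proof -
          have "eventually (\<lambda>N. (\<Sum>n=1..N. cmod (w n)) \<le> \<epsilon> / (2 * K) * real H * real N) sequentially"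
            using elim S unfolding w_def by blast
          then have "eventually (\<lambda>q. (\<Sum>n=1..Nq q. cmod (w n)) \<le> \<epsilon> / (2 * K) * real H * real (Nq q)) sequentially"
            using Nq_top by (rule eventually_compose_filterlim)
          then show ?thesis
            using eventually_ge_at_top[of "1::nat"]
          proof eventually_elim
            case (elim q)
            have Npos: "real (Nq q) > 0" using pos elim(2) by force
            have "cmod (\<Sum>n=1..Nq q. w n * cnj (y n)) \<le> (\<Sum>n=1..Nq q. cmod (w n) * K)"
              using K by (intro sum_norm_le) (auto simp: norm_mult intro!: mult_left_mono)
            also have "\<dots> = (\<Sum>n=1..Nq q. cmod (w n)) * K" by (simp add: sum_distrib_right)
            also have "\<dots> \<le> \<epsilon> / (2 * K) * real H * real (Nq q) * K"
              using elim(1) K by (intro mult_right_mono) auto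
            also have "\<dots> = \<epsilon> / 2 * real H * real (Nq q)" using K by (simp add: field_simps)
            finally show ?case using Npos by (simp add: norm_divide divide_le_eq)
          qed
        qed
        ultimately show ?thesis
          by (intro tendsto_upperbound) auto
      qed
      then have "(\<Sum>h=1..H. cmod (l h)) \<le> 2 * (\<epsilon> / 2 * real H)"
        by (rule sum_cmod_le_sign_patterns)
      then show ?case using elim(2) by (simp add: divide_le_eq)
    qed
  qed
  show "(\<lambda>H::nat. (\<Sum>h=1..H. cmod (l h)) / real H) \<longlonglongrightarrow> 0"
  proof (rule order_tendstoI)
    fix a :: real assume "a < 0"
    moreover have "0 \<le> (\<Sum>h=1..H. cmod (l h)) / real H" for H
      by (intro divide_nonneg_nonneg sum_nonneg) auto
    ultimately show "eventually (\<lambda>H. a < (\<Sum>h=1..H. cmod (l h)) / real H) sequentially"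
      by (intro always_eventually allI) (rule less_le_trans)
  next
    fix a :: real assume "0 < a"
    then have "eventually (\<lambda>H. (\<Sum>h=1..H. cmod (l h)) / real H \<le> a / 2) sequentially"
      by (intro main) simp
    then show "eventually (\<lambda>H. (\<Sum>h=1..H. cmod (l h)) / real H < a) sequentially"
      by eventually_elim (use \<open>0 < a\<close> in linarith)
  qed
qed

theorem theorem1p6:
  fixes M :: "'a measure" and T :: "'a \<Rightarrow> 'a" and f :: "'a \<Rightarrow> complex"
  assumes "weakly_mixing_system M T"
    and "integrable M f"
    and "(LINT x|M. f x) = 0"
  shows "AE x in M. weakly_mixing_sequence (\<lambda>n. f ((T ^^ n) x))"
proof -
  interpret weakly_mixing_system M T by fact
  note f = assms(2) and mean = assms(3)
  \<comment> \<open>The countably many functions whose orbit averages are controlled off one null set.\<close>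
  define F where "F H S x = cmod (\<Sum>h=1..H. sign_on S h *\<^sub>R f ((T ^^ h) x))" for H S x
  have F_int: "integrable M (F H S)" for H S
    using integrable_norm[OF integrable_weighted_sum[OF f, of "sign_on S" 0 H]]
    unfolding F_def diff_zero .
  have "AE x in M. \<forall>H. \<forall>S\<in>Pow {1..H}. \<forall>a > (LINT x|M. F H S x).
      eventually (\<lambda>N. (\<Sum>n=1..N. F H S ((T ^^ n) x)) \<le> a * real N) sequentially"
    unfolding AE_all_countable
    by (intro allI AE_finite_allI orbit_averages_eventually_le F_int) auto
  moreover have "AE x in M. \<forall>a > (LINT x|M. cmod (f x)).
      eventually (\<lambda>N. (\<Sum>n=1..N. cmod (f ((T ^^ n) x))) \<le> a * real N) sequentially"
    using f by (intro orbit_averages_eventually_le) auto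
  ultimately show ?thesis
  proof eventually_elim
    case (elim x)
    show ?case
    proof (rule weakly_mixing_sequenceI)
      let ?a = "(LINT x|M. cmod (f x)) + 1"
      have "eventually (\<lambda>N. (\<Sum>n=1..N. cmod (f ((T ^^ n) x))) \<le> ?a * real N) sequentially"
        using elim(2) by simp
      then have "eventually (\<lambda>N. ereal ((\<Sum>n=1..N. cmod (f ((T ^^ n) x))) / real N) \<le> ereal ?a) sequentially"
        using eventually_gt_at_top[of "0::nat"]
        by eventually_elim (simp add: divide_le_eq)
      then have "limsup (\<lambda>N. ereal ((\<Sum>n=1..N. cmod (f ((T ^^ n) x))) / real N)) \<le> ereal ?a"
        by (rule Limsup_bounded)
      then show "limsup (\<lambda>N. ereal ((\<Sum>n=1..N. cmod (f ((T ^^ n) x))) / real N)) < \<infinity>"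
        by (rule le_less_trans) simp
    next
      fix \<epsilon> :: real assume e: "\<epsilon> > 0"
      then have e2: "\<epsilon> / 2 > 0" by simp
      show "eventually (\<lambda>H. \<forall>S\<subseteq>{1..H}. eventually (\<lambda>N.
        (\<Sum>n=1..N. cmod (\<Sum>h=1..H. sign_on S h *\<^sub>R f ((T ^^ (n + h)) x))) \<le> \<epsilon> * real H * real N)
          sequentially) sequentially"
        using weighted_averages_L1_small[OF f, unfolded L1_averages_vanish_def, rule_format, OF e2]
          eventually_ge_at_top[of "1::nat"]
      proof eventually_elim
        case H: (elim H)
        show ?case
        proof (intro allI impI)
          fix S assume S: "S \<subseteq> {1..H}"
          have "(LINT x|M. F H S x) \<le> \<epsilon> / 2 * real H"
            using H(1)[rule_format, of "sign_on S"] by (simp add: F_def mean sign_on_def)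
          also have "\<dots> < \<epsilon> * real H" using e H(2) by simp
          finally have "eventually (\<lambda>N. (\<Sum>n=1..N. F H S ((T ^^ n) x)) \<le> \<epsilon> * real H * real N) sequentially"
            using elim(1) S by blast
          moreover have "(T ^^ h) ((T ^^ n) x) = (T ^^ (n + h)) x" for n h
            by (simp add: funpow_add add.commute)
          ultimately show "eventually (\<lambda>N. (\<Sum>n=1..N. cmod (\<Sum>h=1..H. sign_on S h *\<^sub>R f ((T ^^ (n + h)) x)))
              \<le> \<epsilon> * real H * real N) sequentially"
            unfolding F_def by simp
        qed
      qed
    qed
  qed
qed

end
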